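(* The position operator $x$ (multiplication by $x$) satisfies $$P_{t,s}\,x\,P_{t,s}^{-1}=x+tD-sD^2.$$
   Context: Here $D=\frac{d}{dx}$, and $P_{t,s}$ is the Heat--Airy semigroup, the two-parameter family of operators $P_{t,s}=\exp\left(\frac t2D^2-\frac s3D^3\right)$, $t,s\ge0$. With $A=\frac t2D^2-\frac s3D^3$, the conjugation $P_{t,s}\,x\,P_{t,s}^{-1}$ means $e^{A}xe^{-A}$. The symbol $x$ denotes the operator of multiplication by the variable $x$, so that $[D,x]=1$. *)

theory Defs
  imports "HOL-Analysis.Analysis"
begin

text \<open>
  Operators act on complex-valued functions of a real variable.  Since \<open>exp (- A)\<close> runs the heat flow
  backwards, an invariant domain on which both \<open>exp A\<close> and \<open>exp (- A)\<close> are given by the exponential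
  series is needed: the restrictions to the real line of the entire functions of growth at most
  order 3/2, minimal type (order 3/2 is dual to the third-order generator).  It contains
  all polynomials, all exponentials \<open>\<lambda>x. exp (c * x)\<close> and all band-limited functions.  Every member is
  smooth, so \<open>vector_derivative\<close> below is a genuine derivative.
\<close>

definition heat_airy_domain :: "(real \<Rightarrow> complex) set" where
  "heat_airy_domain =
     {f. \<exists>F. F holomorphic_on UNIV \<and>
           (\<forall>\<epsilon>>0. \<exists>C. \<forall>z. norm (F z) \<le> C * exp (\<epsilon> * norm z powr (3/2))) \<and>
           (\<forall>x. f x = F (complex_of_real x))}"

definition diff_op :: "(real \<Rightarrow> complex) \<Rightarrow> real \<Rightarrow> complex" where
  "diff_op f = (\<lambda>x. vector_derivative f (at x))"

definition position_op :: "(real \<Rightarrow> complex) \<Rightarrow> real \<Rightarrow> complex" where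
  "position_op f = (\<lambda>x. x *\<^sub>R f x)"

definition heat_airy_gen :: "real \<Rightarrow> real \<Rightarrow> (real \<Rightarrow> complex) \<Rightarrow> real \<Rightarrow> complex" where
  "heat_airy_gen t s f = (\<lambda>x. (t/2) *\<^sub>R (diff_op ^^ 2) f x - (s/3) *\<^sub>R (diff_op ^^ 3) f x)"

definition neg_op :: "((real \<Rightarrow> complex) \<Rightarrow> real \<Rightarrow> complex) \<Rightarrow> (real \<Rightarrow> complex) \<Rightarrow> real \<Rightarrow> complex" where
  "neg_op B f = (\<lambda>x. - B f x)"

text \<open>The exponential series is summed pointwise; \<open>exp_converges\<close> excludes the junk value of a
  divergent \<open>suminf\<close>.\<close>

definition exp_converges ::
    "((real \<Rightarrow> complex) \<Rightarrow> real \<Rightarrow> complex) \<Rightarrow> (real \<Rightarrow> complex) \<Rightarrow> bool" where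
  "exp_converges B f \<longleftrightarrow> (\<forall>x. summable (\<lambda>n. norm ((B ^^ n) f x /\<^sub>R fact n)))"

definition exp_op ::
    "((real \<Rightarrow> complex) \<Rightarrow> real \<Rightarrow> complex) \<Rightarrow> (real \<Rightarrow> complex) \<Rightarrow> real \<Rightarrow> complex" where
  "exp_op B f = (\<lambda>x. \<Sum>n. (B ^^ n) f x /\<^sub>R fact n)"

definition heat_airy :: "real \<Rightarrow> real \<Rightarrow> (real \<Rightarrow> complex) \<Rightarrow> real \<Rightarrow> complex" where
  "heat_airy t s = exp_op (heat_airy_gen t s)"

end

theory Submission
  imports Defs "HOL-Complex_Analysis.Complex_Analysis"
begin

text \<open>
  Everything is lifted to entire functions of growth at most order 3/2, minimal type.  Cauchy's
  estimate on circles of radius proportional to \<open>n powr (2/3)\<close> shows that the \<open>n\<close>-th iterate of the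
  generator \<open>A\<close> grows more slowly than \<open>q ^ n * fact n\<close> for every \<open>q > 0\<close>, within the same growth
  class.  Hence the exponential series converges absolutely and locally uniformly, preserves the
  class, may be differentiated termwise, and may be rearranged to give
  \<open>exp (- A) (exp A F) = F\<close>.  Since \<open>Q = [A, x] = t D - s D\<^sup>2\<close> commutes with \<open>A\<close>,
  \<open>A ^ n x = x A ^ n + n Q A ^ (n - 1)\<close>, and summation yields \<open>exp A x = (x + Q) exp A\<close>.
\<close>

subsection \<open>Two-term differential operators with constant coefficients\<close>

text \<open>One family holds every operator in play: A, the commutator Q and, with
  \<open>a = 1\<close> and \<open>b = 0\<close>, a plain derivative. Commutation and termwise
  application are then proved once for all of them.\<close>

definition diff_poly :: "real \<Rightarrow> nat \<Rightarrow> real \<Rightarrow> nat \<Rightarrow> (complex \<Rightarrow> complex) \<Rightarrow> complex \<Rightarrow> complex" where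
  "diff_poly a i b j F = (\<lambda>z. of_real a * (deriv ^^ i) F z + of_real b * (deriv ^^ j) F z)"

lemma holomorphic_diff_poly:
  assumes "F holomorphic_on UNIV"
  shows "diff_poly a i b j F holomorphic_on UNIV"
  unfolding diff_poly_def by (intro holomorphic_intros assms) auto

lemma higher_deriv_lincomb:
  assumes "F holomorphic_on UNIV" "G holomorphic_on UNIV"
  shows "(deriv ^^ k) (\<lambda>z. a * F z + b * G z) = (\<lambda>z. a * (deriv ^^ k) F z + b * (deriv ^^ k) G z)"
proof
  fix z :: complex
  have "(deriv ^^ k) (\<lambda>z. a * F z + b * G z) z
      = (deriv ^^ k) (\<lambda>z. a * F z) z + (deriv ^^ k) (\<lambda>z. b * G z) z"
    by (rule higher_deriv_add[of _ UNIV]) (auto intro!: holomorphic_intros assms)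
  also have "\<dots> = a * (deriv ^^ k) F z + b * (deriv ^^ k) G z"
    using higher_deriv_cmult[of F UNIV z k a] higher_deriv_cmult[of G UNIV z k b] assms by simp
  finally show "(deriv ^^ k) (\<lambda>z. a * F z + b * G z) z = a * (deriv ^^ k) F z + b * (deriv ^^ k) G z" .
qed

lemma diff_poly_lincomb:
  assumes "F holomorphic_on UNIV" "G holomorphic_on UNIV"
  shows "diff_poly a i b j (\<lambda>z. c * F z + d * G z)
    = (\<lambda>z. c * diff_poly a i b j F z + d * diff_poly a i b j G z)"
  unfolding diff_poly_def higher_deriv_lincomb[OF assms] by (simp add: algebra_simps)

lemma higher_deriv_higher_deriv: "(deriv ^^ k) ((deriv ^^ i) F) = (deriv ^^ (k + i)) F"
  by (simp add: funpow_add)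

lemma higher_deriv_diff_poly:
  assumes "F holomorphic_on UNIV"
  shows "(deriv ^^ k) (diff_poly a i b j F) = diff_poly a i b j ((deriv ^^ k) F)"
proof -
  have h: "(deriv ^^ n) F holomorphic_on UNIV" for n
    by (intro holomorphic_intros assms) auto
  show ?thesis
    unfolding diff_poly_def higher_deriv_lincomb[OF h h] higher_deriv_higher_deriv
    by (simp add: add.commute)
qed

lemma diff_poly_commute:
  assumes "F holomorphic_on UNIV"
  shows "diff_poly a i b j (diff_poly a' i' b' j' F) = diff_poly a' i' b' j' (diff_poly a i b j F)"
proof -
  have h: "(deriv ^^ n) F holomorphic_on UNIV" for n
    by (intro holomorphic_intros assms) auto
  have "diff_poly a i b j (diff_poly a' i' b' j' F)
      = diff_poly a i b j (\<lambda>z. of_real a' * (deriv ^^ i') F z + of_real b' * (deriv ^^ j') F z)"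
    by (simp add: diff_poly_def[of a'])
  also have "\<dots> = (\<lambda>z. of_real a' * diff_poly a i b j ((deriv ^^ i') F) z
                     + of_real b' * diff_poly a i b j ((deriv ^^ j') F) z)"
    by (rule diff_poly_lincomb[OF h h])
  also have "\<dots> = diff_poly a' i' b' j' (diff_poly a i b j F)"
    unfolding diff_poly_def[of a'] higher_deriv_diff_poly[OF assms] by simp
  finally show ?thesis .
qed

text \<open>The Leibniz rule stops after two terms, since the second derivative of z vanishes. At
  \<open>k = 0\<close> the truncated index \<open>k - 1\<close> is harmless because its coefficient
  is 0.\<close>

lemma higher_deriv_mult_id:
  assumes "F holomorphic_on UNIV"
  shows "(deriv ^^ k) (\<lambda>z. z * F z) = (\<lambda>z. z * (deriv ^^ k) F z + of_nat k * (deriv ^^ (k - 1)) F z)"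
proof (induction k)
  case (Suc k)
  have "deriv (\<lambda>z. z * (deriv ^^ k) F z + of_nat k * (deriv ^^ (k - 1)) F z) z
     = z * (deriv ^^ Suc k) F z + of_nat (Suc k) * (deriv ^^ (Suc k - 1)) F z" for z
  proof -
    have d: "((deriv ^^ n) F has_field_derivative (deriv ^^ Suc n) F z) (at z)" for n
      by (rule has_field_derivative_higher_deriv[OF assms]) auto
    show ?thesis
      by (rule DERIV_imp_deriv)
         (cases k; use d[of 0] in \<open>auto intro!: derivative_eq_intros d simp: algebra_simps simp del: funpow.simps(2)\<close>)
  qed
  then show ?case
    by (simp add: Suc.IH fun_eq_iff)
qed auto

definition entire_gen :: "real \<Rightarrow> real \<Rightarrow> (complex \<Rightarrow> complex) \<Rightarrow> complex \<Rightarrow> complex" where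
  "entire_gen t s = diff_poly (t/2) 2 (- (s/3)) 3"

text \<open>This is Q = [A, z]: the Leibniz factors 2 and 3 cancel the denominators in (t/2) D^2 -
  (s/3) D^3.\<close>

definition gen_commutator :: "real \<Rightarrow> real \<Rightarrow> (complex \<Rightarrow> complex) \<Rightarrow> complex \<Rightarrow> complex" where
  "gen_commutator t s = diff_poly t 1 (- s) 2"

lemma holomorphic_entire_gen_funpow:
  assumes "F holomorphic_on UNIV"
  shows "(entire_gen t s ^^ n) F holomorphic_on UNIV"
  by (induction n) (auto simp: assms entire_gen_def holomorphic_diff_poly)

lemma diff_poly_entire_gen_funpow:
  assumes "F holomorphic_on UNIV"
  shows "diff_poly a i b j ((entire_gen t s ^^ n) F) = (entire_gen t s ^^ n) (diff_poly a i b j F)"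
proof (induction n)
  case (Suc n)
  have "diff_poly a i b j ((entire_gen t s ^^ Suc n) F)
      = entire_gen t s (diff_poly a i b j ((entire_gen t s ^^ n) F))"
    using diff_poly_commute[OF holomorphic_entire_gen_funpow[OF assms]]
    by (simp add: entire_gen_def)
  then show ?case by (simp add: Suc.IH)
qed auto

lemma deriv_entire_gen_funpow:
  assumes "F holomorphic_on UNIV"
  shows "deriv ((entire_gen t s ^^ n) F) = (entire_gen t s ^^ n) (deriv F)"
  using diff_poly_entire_gen_funpow[OF assms, where a = 1 and i = 1 and b = 0] by (simp add: diff_poly_def)

lemma entire_gen_mult_id:
  assumes "F holomorphic_on UNIV"
  shows "entire_gen t s (\<lambda>z. z * F z) = (\<lambda>z. z * entire_gen t s F z + gen_commutator t s F z)"
  unfolding entire_gen_def gen_commutator_def diff_poly_def higher_deriv_mult_id[OF assms]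
  by (simp add: algebra_simps numeral_eq_Suc)

text \<open>Each of the n copies of A, moved past z, leaves one Q. It slides through the other
  copies because constant-coefficient operators commute, so Q can be put innermost, directly on
  \<open>F\<close>.\<close>

lemma entire_gen_funpow_mult_id:
  assumes "F holomorphic_on UNIV"
  shows "(entire_gen t s ^^ n) (\<lambda>z. z * F z)
    = (\<lambda>z. z * (entire_gen t s ^^ n) F z
         + of_nat n * (entire_gen t s ^^ (n - 1)) (gen_commutator t s F) z)"
proof (induction n)
  case (Suc n)
  let ?A = "entire_gen t s" and ?Q = "gen_commutator t s"
  have hA: "(?A ^^ m) F holomorphic_on UNIV" for m
    by (rule holomorphic_entire_gen_funpow[OF assms])
  have hQ: "(?A ^^ m) (?Q F) holomorphic_on UNIV" for m
    unfolding gen_commutator_def by (intro holomorphic_entire_gen_funpow holomorphic_diff_poly assms)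
  have hx: "(\<lambda>z. z * (?A ^^ n) F z) holomorphic_on UNIV"
    by (intro holomorphic_intros hA)
  have Q: "?Q ((?A ^^ n) F) = (?A ^^ n) (?Q F)"
    unfolding gen_commutator_def by (rule diff_poly_entire_gen_funpow[OF assms])
  \<comment> \<open>The factor 1 brings the sum into the shape of
    \<open>diff_poly_lincomb\<close>.\<close>
  have "(?A ^^ Suc n) (\<lambda>z. z * F z)
      = ?A (\<lambda>z. 1 * (z * (?A ^^ n) F z) + of_nat n * (?A ^^ (n - 1)) (?Q F) z)"
    by (simp add: Suc.IH)
  also have "\<dots> = (\<lambda>z. 1 * ?A (\<lambda>z. z * (?A ^^ n) F z) z + of_nat n * ?A ((?A ^^ (n - 1)) (?Q F)) z)"
    unfolding entire_gen_def by (rule diff_poly_lincomb[OF hx[unfolded entire_gen_def] hQ[unfolded entire_gen_def]])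
  also have "\<dots> = (\<lambda>z. z * (?A ^^ Suc n) F z + of_nat (Suc n) * (?A ^^ n) (?Q F) z)"
    unfolding entire_gen_mult_id[OF hA] Q by (cases n) (auto simp: algebra_simps)
  finally show ?case by simp
qed auto

text \<open>Expanding A^n produces only derivatives of orders 2n to 3n, with coefficients whose
  absolute values sum to (|t|/2 + |s|/3)^n.\<close>

lemma norm_entire_gen_funpow_le:
  assumes "F holomorphic_on UNIV"
    and "\<And>j. 2 * n \<le> j \<Longrightarrow> j \<le> 3 * n \<Longrightarrow> norm ((deriv ^^ j) F z) \<le> B"
  shows "norm ((entire_gen t s ^^ n) F z) \<le> (\<bar>t\<bar>/2 + \<bar>s\<bar>/3) ^ n * B"
  using assms
proof (induction n arbitrary: F B)
  case 0
  then show ?case using "0.prems"(2)[of 0] by simp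
next
  case (Suc n)
  let ?A = "entire_gen t s" and ?c = "\<bar>t\<bar>/2 + \<bar>s\<bar>/3"
  \<comment> \<open>The function A F meets the induction hypothesis with the bound
    \<open>?c * B\<close>, since \<open>j + 2\<close> and \<open>j + 3\<close> lie between 2(n+1)
    and 3(n+1).\<close>
  have "norm ((deriv ^^ j) (?A F) z) \<le> ?c * B" if j: "2 * n \<le> j" "j \<le> 3 * n" for j
  proof -
    have "(deriv ^^ j) (?A F) z
        = of_real (t/2) * (deriv ^^ (j + 2)) F z - of_real (s/3) * (deriv ^^ (j + 3)) F z"
      unfolding entire_gen_def higher_deriv_diff_poly[OF Suc.prems(1)]
      unfolding diff_poly_def higher_deriv_higher_deriv by (simp add: add.commute)
    also have "norm \<dots> \<le> norm (of_real (t/2) * (deriv ^^ (j + 2)) F z)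
                          + norm (of_real (s/3) * (deriv ^^ (j + 3)) F z)"
      by (rule norm_triangle_ineq4)
    also have "\<dots> = \<bar>t\<bar>/2 * norm ((deriv ^^ (j + 2)) F z) + \<bar>s\<bar>/3 * norm ((deriv ^^ (j + 3)) F z)"
      by (simp add: norm_mult)
    also have "\<dots> \<le> \<bar>t\<bar>/2 * B + \<bar>s\<bar>/3 * B"
      using Suc.prems(2)[of "j + 2"] Suc.prems(2)[of "j + 3"] j
      by (intro add_mono mult_left_mono) auto
    finally show ?thesis by (simp add: algebra_simps)
  qed
  then have "norm ((?A ^^ n) (?A F) z) \<le> ?c ^ n * (?c * B)"
    by (intro Suc.IH) (auto simp: entire_gen_def intro: holomorphic_diff_poly Suc.prems(1))
  then show ?case by (simp add: funpow_swap1 mult_ac)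
qed

subsection \<open>Entire functions of order 3/2 and minimal type\<close>

text \<open>These are the entire extensions of the members of \<open>heat_airy_domain\<close>; on
  them Cauchy's estimate is available.\<close>

definition airy_entire :: "(complex \<Rightarrow> complex) set" where
  "airy_entire = {F. F holomorphic_on UNIV \<and>
     (\<forall>\<epsilon>>0. \<exists>C. \<forall>z. norm (F z) \<le> C * exp (\<epsilon> * norm z powr (3/2)))}"

lemma airy_entire_holomorphic: "F \<in> airy_entire \<Longrightarrow> F holomorphic_on UNIV"
  by (simp add: airy_entire_def)

lemma airy_entire_bound:
  assumes "F \<in> airy_entire" "\<epsilon> > 0"
  obtains C where "C \<ge> 0" "\<And>z. norm (F z) \<le> C * exp (\<epsilon> * norm z powr (3/2))"
proof -
  obtain C where C: "\<And>z. norm (F z) \<le> C * exp (\<epsilon> * norm z powr (3/2))"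
    using assms by (auto simp: airy_entire_def)
  \<comment> \<open>At z = 0 the exponential equals 1, so \<open>C\<close> dominates
    \<open>norm (F 0)\<close>.\<close>
  moreover have "C \<ge> 0"
    using C[of 0] order_trans[OF norm_ge_zero[of "F 0"]] by simp
  ultimately show ?thesis using that by blast
qed

text \<open>Bound a + b by twice the maximum; the constant 4 is a crude upper bound for
  \<open>2 powr (3/2)\<close>.\<close>

lemma add_powr_three_halves_le:
  assumes "a \<ge> 0" "b \<ge> 0"
  shows "(a + b) powr (3/2) \<le> 4 * (a powr (3/2) + b powr (3/2) :: real)"
proof -
  have "(a + b) powr (3/2) \<le> (2 * max a b) powr (3/2)"
    using assms by (intro powr_mono2) auto
  also have "\<dots> = 2 powr (3/2) * max a b powr (3/2)"
    by (rule powr_mult)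
  also have "\<dots> \<le> 2 powr 2 * max a b powr (3/2)"
    by (intro mult_right_mono powr_mono) auto
  also have "\<dots> \<le> 4 * (a powr (3/2) + b powr (3/2))"
    by (auto simp: max_def)
  finally show ?thesis .
qed

text \<open>This transfers the growth bound from a centre z to a circle around it, splitting the
  exponent into a part in z and a part in the radius.\<close>

lemma norm_le_airy_bound_shift:
  assumes "\<And>z. norm (F z) \<le> C * exp (\<delta> * norm z powr (3/2))" "C \<ge> 0" "\<delta> \<ge> 0"
    and "norm w \<le> norm z + r" "r \<ge> 0"
  shows "norm (F w) \<le> C * exp (4 * \<delta> * norm z powr (3/2) + 4 * \<delta> * r powr (3/2))"
proof -
  have "norm w powr (3/2) \<le> (norm z + r) powr (3/2)"
    using assms by (intro powr_mono2) auto
  also have "\<dots> \<le> 4 * (norm z powr (3/2) + r powr (3/2))"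
    using assms by (intro add_powr_three_halves_le) auto
  finally have "\<delta> * norm w powr (3/2) \<le> \<delta> * (4 * (norm z powr (3/2) + r powr (3/2)))"
    using assms(3) by (intro mult_left_mono) auto
  then have "C * exp (\<delta> * norm w powr (3/2))
      \<le> C * exp (4 * \<delta> * norm z powr (3/2) + 4 * \<delta> * r powr (3/2))"
    using assms(2) by (intro mult_left_mono) (auto simp: algebra_simps)
  with assms(1)[of w] show ?thesis by linarith
qed

text \<open>Cauchy's estimate with the radius left free, so that it can later grow with the number
  of iterations.\<close>

lemma norm_higher_deriv_airy_le:
  assumes "F holomorphic_on UNIV"
    and "\<And>z. norm (F z) \<le> C * exp (\<delta> * norm z powr (3/2))" "C \<ge> 0" "\<delta> \<ge> 0" "r > 0"
  shows "norm ((deriv ^^ j) F z)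
    \<le> fact j * (C * exp (4 * \<delta> * norm z powr (3/2) + 4 * \<delta> * r powr (3/2))) / r ^ j"
proof (rule Cauchy_inequality)
  show "F holomorphic_on ball z r"
    using assms(1) by (rule holomorphic_on_subset) auto
  show "continuous_on (cball z r) F"
    using assms(1) holomorphic_on_imp_continuous_on holomorphic_on_subset by blast
  fix w assume w: "norm (z - w) = r"
  have "norm w \<le> norm z + r"
    using norm_triangle_ineq4[of z "z - w"] w by simp
  then show "norm (F w) \<le> C * exp (4 * \<delta> * norm z powr (3/2) + 4 * \<delta> * r powr (3/2))"
    using assms by (intro norm_le_airy_bound_shift) auto
qed fact

lemma airy_entire_deriv:
  assumes "F \<in> airy_entire"
  shows "deriv F \<in> airy_entire"
proof -
  have "\<exists>C. \<forall>z. norm (deriv F z) \<le> C * exp (\<epsilon> * norm z powr (3/2))" if "\<epsilon> > 0" for \<epsilon>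
  proof -
    \<comment> \<open>Cauchy's estimate multiplies the rate by 4, hence \<epsilon>/4; with radius 1
      the remaining factor is the constant e^\<epsilon>.\<close>
    obtain C where C: "C \<ge> 0" "\<And>z. norm (F z) \<le> C * exp (\<epsilon>/4 * norm z powr (3/2))"
      using airy_entire_bound[OF assms, of "\<epsilon>/4"] \<open>\<epsilon> > 0\<close> by auto
    have "norm (deriv F z) \<le> C * exp \<epsilon> * exp (\<epsilon> * norm z powr (3/2))" for z
      using norm_higher_deriv_airy_le[OF airy_entire_holomorphic[OF assms] C(2,1), of 1 1 z] \<open>\<epsilon> > 0\<close>
      by (simp add: exp_add mult_ac)
    then show ?thesis by blast
  qed
  moreover have "deriv F holomorphic_on UNIV"
    using airy_entire_holomorphic[OF assms] by (intro holomorphic_deriv) auto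
  ultimately show ?thesis by (auto simp: airy_entire_def)
qed

lemma airy_entire_higher_deriv: "F \<in> airy_entire \<Longrightarrow> (deriv ^^ k) F \<in> airy_entire"
  by (induction k) (auto intro: airy_entire_deriv)

lemma airy_entire_lincomb:
  assumes "F \<in> airy_entire" "G \<in> airy_entire"
  shows "(\<lambda>z. a * F z + b * G z) \<in> airy_entire"
proof -
  have "\<exists>C. \<forall>z. norm (a * F z + b * G z) \<le> C * exp (\<epsilon> * norm z powr (3/2))" if "\<epsilon> > 0" for \<epsilon>
  proof -
    obtain C where C: "\<And>z. norm (F z) \<le> C * exp (\<epsilon> * norm z powr (3/2))"
      using airy_entire_bound[OF assms(1) \<open>\<epsilon> > 0\<close>] by auto
    obtain D where D: "\<And>z. norm (G z) \<le> D * exp (\<epsilon> * norm z powr (3/2))"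
      using airy_entire_bound[OF assms(2) \<open>\<epsilon> > 0\<close>] by auto
    have "norm (a * F z + b * G z) \<le> (norm a * C + norm b * D) * exp (\<epsilon> * norm z powr (3/2))" for z
    proof -
      have "norm (a * F z + b * G z) \<le> norm a * norm (F z) + norm b * norm (G z)"
        by (metis norm_mult norm_triangle_ineq)
      also have "\<dots> \<le> norm a * (C * exp (\<epsilon> * norm z powr (3/2))) + norm b * (D * exp (\<epsilon> * norm z powr (3/2)))"
        by (intro add_mono mult_left_mono C D) auto
      finally show ?thesis by (simp add: algebra_simps)
    qed
    then show ?thesis by blast
  qed
  then show ?thesis
    using assms by (auto simp: airy_entire_def intro!: holomorphic_intros)
qed

lemma airy_entire_diff_poly: "F \<in> airy_entire \<Longrightarrow> diff_poly a i b j F \<in> airy_entire"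
  unfolding diff_poly_def by (intro airy_entire_lincomb airy_entire_higher_deriv)

lemma airy_entire_entire_gen_funpow: "F \<in> airy_entire \<Longrightarrow> (entire_gen t s ^^ n) F \<in> airy_entire"
  by (induction n) (auto simp: entire_gen_def airy_entire_diff_poly)

lemma airy_entire_mult_id:
  assumes "F \<in> airy_entire"
  shows "(\<lambda>z. z * F z) \<in> airy_entire"
proof -
  have "\<exists>C. \<forall>z. norm (z * F z) \<le> C * exp (\<epsilon> * norm z powr (3/2))" if "\<epsilon> > 0" for \<epsilon>
  proof -
    obtain C where C: "C \<ge> 0" "\<And>z. norm (F z) \<le> C * exp (\<epsilon>/2 * norm z powr (3/2))"
      using airy_entire_bound[OF assms, of "\<epsilon>/2"] \<open>\<epsilon> > 0\<close> by auto
    \<comment> \<open>Half of the rate bounds \<open>F\<close>; the other half absorbs the factor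
      |z|, which is at most a multiple of exp((\<epsilon>/2) |z|^(3/2)).\<close>
    have "norm (z * F z) \<le> (1 + 2/\<epsilon>) * C * exp (\<epsilon> * norm z powr (3/2))" for z
    proof -
      let ?y = "norm z powr (3/2)"
      have "norm z \<le> 1 + ?y"
      proof (cases "norm z \<le> 1")
        case False
        then have "norm z powr 1 \<le> ?y" by (intro powr_mono) auto
        with False show ?thesis by simp
      qed (use powr_ge_zero[of "norm z" "3/2"] in linarith)
      also have "\<dots> \<le> (1 + 2/\<epsilon>) * (1 + \<epsilon>/2 * ?y)"
        using \<open>\<epsilon> > 0\<close> by (simp add: field_simps)
      also have "\<dots> \<le> (1 + 2/\<epsilon>) * exp (\<epsilon>/2 * ?y)"
        using \<open>\<epsilon> > 0\<close> by (intro mult_left_mono exp_ge_add_one_self) auto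
      finally have "norm (z * F z) \<le> ((1 + 2/\<epsilon>) * exp (\<epsilon>/2 * ?y)) * (C * exp (\<epsilon>/2 * ?y))"
        unfolding norm_mult using C \<open>\<epsilon> > 0\<close> by (intro mult_mono) auto
      also have "\<dots> = (1 + 2/\<epsilon>) * C * exp (\<epsilon>/2 * ?y + \<epsilon>/2 * ?y)"
        unfolding exp_add by (simp only: mult_ac)
      finally show ?thesis by simp
    qed
    then show ?thesis by blast
  qed
  then show ?thesis
    using assms by (auto simp: airy_entire_def intro!: holomorphic_intros)
qed

subsection \<open>Growth of the iterates of the generator\<close>

text \<open>n^n / n! is a single term of the nonnegative exponential series for e^n.\<close>

lemma power_self_le_exp_fact: "real n ^ n \<le> exp (real n) * fact n"
proof -
  have "(\<lambda>k. real n ^ k /\<^sub>R fact k) sums exp (real n)"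
    by (rule exp_converges)
  then have "(\<Sum>k\<in>{n}. real n ^ k /\<^sub>R fact k) \<le> exp (real n)"
    using sum_le_suminf[where f = "\<lambda>k. real n ^ k /\<^sub>R fact k" and I = "{n}"] by (auto simp: sums_iff)
  then show ?thesis by (simp add: field_simps)
qed

text \<open>Here p is the cube root of n and R p^2 the Cauchy radius. From j! \<le> (3n)^j the
  quotient is at most (3/R)^j p^j; as 3/R \<le> 1 \<le> p, the first factor is largest at j = 2n and
  the second at j = 3n.\<close>

lemma fact_div_power_le:
  assumes "p \<ge> 1" "p ^ 3 = real n" "R \<ge> 3" "2 * n \<le> j" "j \<le> 3 * n"
  shows "fact j / (R * p\<^sup>2) ^ j \<le> (9 / R\<^sup>2) ^ n * real n ^ n"
proof -
  have "fact j \<le> real j ^ j"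
    using fact_le_power[of j, where 'a = real] by simp
  also have "\<dots> \<le> (3 * p ^ 3) ^ j"
    using assms by (intro power_mono) auto
  finally have "fact j / (R * p\<^sup>2) ^ j \<le> (3 * p ^ 3) ^ j / (R * p\<^sup>2) ^ j"
    using assms by (intro divide_right_mono) auto
  also have "\<dots> = (3 * p ^ 3 / (R * p\<^sup>2)) ^ j"
    by (simp add: power_divide)
  also have "3 * p ^ 3 / (R * p\<^sup>2) = 3 / R * p"
    using assms by (simp add: field_simps power2_eq_square power3_eq_cube)
  also have "(3 / R * p) ^ j = (3 / R) ^ j * p ^ j"
    by (rule power_mult_distrib)
  also have "\<dots> \<le> (3 / R) ^ (2 * n) * p ^ (3 * n)"
    using assms by (intro mult_mono power_decreasing power_increasing) auto
  also have "\<dots> = (9 / R\<^sup>2) ^ n * real n ^ n"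
    using assms(2) by (simp add: power_mult power_divide)
  finally show ?thesis .
qed

text \<open>The order of the choices matters: \<open>R\<close> is fixed first, large enough to push
  the geometric factor below \<open>q\<close>; only then is \<open>\<delta>\<close> taken small in
  terms of \<open>R\<close>, which minimal type permits.\<close>

lemma entire_gen_funpow_growth:
  assumes F: "F \<in> airy_entire" and "q > 0" "\<epsilon> > 0"
  obtains C where "C \<ge> 0"
    "\<And>n z. norm ((entire_gen t s ^^ n) F z) \<le> C * q ^ n * fact n * exp (\<epsilon> * norm z powr (3/2))"
proof -
  define c where "c = \<bar>t\<bar>/2 + \<bar>s\<bar>/3"
  \<comment> \<open>\<open>K\<close> collects the constants: 9 from
    \<open>fact_div_power_le\<close>, \<open>c\<close> from the expansion of A^n, and two factors e,
    one from n^n \<le> e^n n! and one from the growth of \<open>F\<close> on the circle.\<close>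
  define K where "K = 9 * c * exp 1 ^ 2"
  \<comment> \<open>The summand 3 meets the hypothesis of \<open>fact_div_power_le\<close>; the
    summand \<open>K / q\<close> gives K \<le> q R and hence
    \<open>K / R\<^sup>2 \<le> q\<close>.\<close>
  define R where "R = 3 + K / q"
  \<comment> \<open>The first entry keeps the rate \<open>4 * \<delta>\<close> from Cauchy's
    estimate below \<epsilon>; the second makes a circle of radius R n^(2/3) cost at most
    e^n.\<close>
  define \<delta> where "\<delta> = min (\<epsilon>/4) (1 / (4 * R powr (3/2)))"
  have c: "c \<ge> 0" by (simp add: c_def)
  then have K: "K \<ge> 0" by (simp add: K_def)
  then have R: "R \<ge> 3" using \<open>q > 0\<close> by (simp add: R_def)
  have \<delta>: "\<delta> > 0" "4 * \<delta> \<le> \<epsilon>" using R \<open>\<epsilon> > 0\<close> by (auto simp: \<delta>_def)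
  have "\<delta> \<le> 1 / (4 * R powr (3/2))" by (simp add: \<delta>_def)
  then have \<delta>R: "4 * \<delta> * R powr (3/2) \<le> 1" using R by (simp add: field_simps)
  have Kq: "K / R\<^sup>2 \<le> q"
  proof -
    have "K \<le> q * R" using \<open>q > 0\<close> by (simp add: R_def field_simps)
    also have "\<dots> \<le> q * R\<^sup>2"
      using R \<open>q > 0\<close> by (intro mult_left_mono) (auto simp: power2_eq_square)
    finally show ?thesis using R by (simp add: field_simps)
  qed
  obtain C where C: "C \<ge> 0" "\<And>z. norm (F z) \<le> C * exp (\<delta> * norm z powr (3/2))"
    using airy_entire_bound[OF F \<delta>(1)] by auto
  have "norm ((entire_gen t s ^^ n) F z) \<le> C * q ^ n * fact n * exp (\<epsilon> * norm z powr (3/2))" for n z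
  \<comment> \<open>For n = 0 the radius R n^(2/3) would vanish; there \<delta> \<le> \<epsilon>
    suffices.\<close>
  proof (cases "n = 0")
    case True
    have "C * exp (\<delta> * norm z powr (3/2)) \<le> C * exp (\<epsilon> * norm z powr (3/2))"
      using C \<delta> by (auto intro!: mult_left_mono mult_right_mono)
    with C(2)[of z] True show ?thesis by simp
  next
    case False
    let ?E = "exp (\<epsilon> * norm z powr (3/2))"
    define p where "p = real n powr (1/3)"
    have p: "p \<ge> 1" "p ^ 3 = real n"
      using False by (auto simp: p_def powr_power intro: ge_one_powr_ge_zero)
    have r: "R * p\<^sup>2 > 0" using R p by auto
    \<comment> \<open>The order 3/2 fits the third-order generator at this point: the radius R p^2
      raised to the power 3/2 is linear in n.\<close>
    have "p powr 3 = real n" using p by (simp flip: powr_numeral)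
    then have rp: "(R * p\<^sup>2) powr (3/2) = R powr (3/2) * real n"
      using R p by (simp add: powr_mult powr_powr flip: powr_numeral)
    have exp_le: "exp (4 * \<delta> * norm z powr (3/2) + 4 * \<delta> * (R * p\<^sup>2) powr (3/2)) \<le> exp (real n) * ?E"
    proof -
      have "4 * \<delta> * norm z powr (3/2) \<le> \<epsilon> * norm z powr (3/2)"
        using \<delta> by (intro mult_right_mono) auto
      moreover have "4 * \<delta> * (R * p\<^sup>2) powr (3/2) \<le> real n"
        using mult_right_mono[OF \<delta>R, of "real n"] by (simp add: rp)
      ultimately show ?thesis by (simp flip: exp_add)
    qed
    have "norm ((deriv ^^ j) F z) \<le> (9 / R\<^sup>2) ^ n * real n ^ n * (C * (exp (real n) * ?E))"
      if j: "2 * n \<le> j" "j \<le> 3 * n" for j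
    proof -
      have "norm ((deriv ^^ j) F z)
        \<le> fact j * (C * exp (4 * \<delta> * norm z powr (3/2) + 4 * \<delta> * (R * p\<^sup>2) powr (3/2))) / (R * p\<^sup>2) ^ j"
        using \<delta> by (intro norm_higher_deriv_airy_le airy_entire_holomorphic F C r) auto
      also have "\<dots> = fact j / (R * p\<^sup>2) ^ j * (C * exp (4 * \<delta> * norm z powr (3/2) + 4 * \<delta> * (R * p\<^sup>2) powr (3/2)))"
        by simp
      also have "\<dots> \<le> (9 / R\<^sup>2) ^ n * real n ^ n * (C * (exp (real n) * ?E))"
        using C(1) by (intro mult_mono fact_div_power_le p R j exp_le) auto
      finally show ?thesis .
    qed
    then have "norm ((entire_gen t s ^^ n) F z)
        \<le> c ^ n * ((9 / R\<^sup>2) ^ n * real n ^ n * (C * (exp (real n) * ?E)))"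
      unfolding c_def by (intro norm_entire_gen_funpow_le airy_entire_holomorphic F)
    also have "\<dots> \<le> c ^ n * ((9 / R\<^sup>2) ^ n * (exp (real n) * fact n) * (C * (exp (real n) * ?E)))"
      using C(1) c by (intro mult_left_mono mult_right_mono power_self_le_exp_fact) auto
    also have "\<dots> = C * (K / R\<^sup>2) ^ n * fact n * ?E"
      using exp_of_nat_mult[of n "1::real"]
      by (simp add: K_def power_mult_distrib power_divide power_mult mult_ac power2_eq_square)
    also have "\<dots> \<le> C * q ^ n * fact n * ?E"
      using C(1) K Kq R by (intro mult_left_mono mult_right_mono power_mono) auto
    finally show ?thesis .
  qed
  with C(1) show ?thesis using that by blast
qed

subsection \<open>The exponential series\<close>

definition entire_exp :: "real \<Rightarrow> real \<Rightarrow> (complex \<Rightarrow> complex) \<Rightarrow> complex \<Rightarrow> complex" where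
  "entire_exp t s F = (\<lambda>z. \<Sum>n. (entire_gen t s ^^ n) F z /\<^sub>R fact n)"

text \<open>The growth bound at q = 1/2. The factors in z and n separate, so it serves absolute
  convergence, local uniformity and the growth of the sum alike.\<close>

lemma entire_exp_terms_bound:
  assumes "F \<in> airy_entire" "\<epsilon> > 0"
  obtains C where "C \<ge> 0"
    "\<And>n z. norm ((entire_gen t s ^^ n) F z /\<^sub>R fact n) \<le> C * exp (\<epsilon> * norm z powr (3/2)) * (1/2) ^ n"
proof -
  obtain C where C: "C \<ge> 0"
    "\<And>n z. norm ((entire_gen t s ^^ n) F z) \<le> C * (1/2) ^ n * fact n * exp (\<epsilon> * norm z powr (3/2))"
    using entire_gen_funpow_growth[OF assms(1), of "1/2" \<epsilon> t s] assms(2) by auto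
  have "norm ((entire_gen t s ^^ n) F z /\<^sub>R fact n) \<le> C * exp (\<epsilon> * norm z powr (3/2)) * (1/2) ^ n" for n z
    using C(2)[of n z] by (simp add: field_simps)
  with C(1) show ?thesis using that by blast
qed

lemma summable_norm_entire_exp:
  assumes "F \<in> airy_entire"
  shows "summable (\<lambda>n. norm ((entire_gen t s ^^ n) F z /\<^sub>R fact n))"
proof -
  obtain C where "C \<ge> 0" and C:
    "\<And>n z. norm ((entire_gen t s ^^ n) F z /\<^sub>R fact n) \<le> C * exp (1 * norm z powr (3/2)) * (1/2) ^ n"
    using entire_exp_terms_bound[OF assms, of 1 t s] by auto
  show ?thesis
  proof (rule summable_comparison_test')
    show "summable (\<lambda>n. C * exp (1 * norm z powr (3/2)) * (1/2) ^ n)"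
      by (intro summable_mult summable_geometric) auto
    show "norm (norm ((entire_gen t s ^^ n) F z /\<^sub>R fact n))
        \<le> C * exp (1 * norm z powr (3/2)) * (1/2) ^ n" for n
      using C[of n z] by simp
  qed
qed

lemma entire_exp_sums:
  assumes "F \<in> airy_entire"
  shows "(\<lambda>n. (entire_gen t s ^^ n) F z /\<^sub>R fact n) sums entire_exp t s F z"
  unfolding entire_exp_def
  using summable_norm_cancel[OF summable_norm_entire_exp[OF assms]] by (rule summable_sums)

text \<open>Since D commutes with A, the differentiated terms are again the terms of an exponential
  series, now for \<open>deriv F\<close>.\<close>

lemma entire_exp_has_field_derivative:
  assumes F: "F \<in> airy_entire"
  shows "(entire_exp t s F has_field_derivative entire_exp t s (deriv F) z) (at z)"
proof -
  let ?f = "\<lambda>n z. (entire_gen t s ^^ n) F z /\<^sub>R fact n"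
  let ?f' = "\<lambda>n z. (entire_gen t s ^^ n) (deriv F) z /\<^sub>R fact n"
  obtain C where C: "C \<ge> 0" "\<And>n z. norm (?f n z) \<le> C * exp (1 * norm z powr (3/2)) * (1/2) ^ n"
    using entire_exp_terms_bound[OF F, of 1 t s] by auto
  have "\<exists>g g'. \<forall>z\<in>UNIV. (\<lambda>n. ?f n z) sums g z \<and> (\<lambda>n. ?f' n z) sums g' z
      \<and> (g has_field_derivative g' z) (at z)"
  proof (rule series_and_derivative_comparison_local)
    fix n and z :: complex
    have "((entire_gen t s ^^ n) F has_field_derivative (entire_gen t s ^^ n) (deriv F) z) (at z)"
      using holomorphic_derivI[OF holomorphic_entire_gen_funpow[OF airy_entire_holomorphic[OF F]], where x = z]
      by (simp add: deriv_entire_gen_funpow[OF airy_entire_holomorphic[OF F]])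
    then show "(?f n has_field_derivative ?f' n z) (at z)"
      unfolding scaleR_conv_of_real by (rule DERIV_cmult)
  next
    fix z :: complex
    \<comment> \<open>A geometric majorant valid on the whole unit ball around
      \<open>z\<close>.\<close>
    let ?h = "\<lambda>n. C * exp ((norm z + 1) powr (3/2)) * (1/2) ^ n"
    have "norm (?f n y) \<le> ?h n" if "y \<in> ball z 1" for n y
    proof -
      have "norm y \<le> norm z + 1"
        using that norm_triangle_ineq2[of y z] by (simp add: dist_norm norm_minus_commute)
      then have "norm y powr (3/2) \<le> (norm z + 1) powr (3/2)"
        by (intro powr_mono2) auto
      then have "C * exp (1 * norm y powr (3/2)) * (1/2) ^ n \<le> ?h n"
        using C(1) by (intro mult_right_mono mult_left_mono) auto
      with C(2)[of n y] show ?thesis by linarith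
    qed
    moreover have "summable ?h"
      by (intro summable_mult summable_geometric) auto
    ultimately show "\<exists>d h. 0 < d \<and> summable h \<and>
        (\<forall>\<^sub>F n in sequentially. \<forall>y\<in>ball z d \<inter> UNIV. norm (?f n y) \<le> h n)"
      by (intro exI[of _ 1] exI[of _ ?h]) auto
  qed auto
  then obtain g g' where g: "\<And>z. (\<lambda>n. ?f n z) sums g z" "\<And>z. (\<lambda>n. ?f' n z) sums g' z"
    "\<And>z. (g has_field_derivative g' z) (at z)"
    by auto
  \<comment> \<open>The comparison theorem yields only some \<open>g\<close> and \<open>g'\<close>;
    uniqueness of sums identifies them.\<close>
  have "g = entire_exp t s F" "g' = entire_exp t s (deriv F)"
    using g by (auto simp: entire_exp_def fun_eq_iff sums_iff)
  with g(3) show ?thesis by simp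
qed

lemma deriv_entire_exp:
  assumes "F \<in> airy_entire"
  shows "deriv (entire_exp t s F) = entire_exp t s (deriv F)"
  by (rule ext) (rule DERIV_imp_deriv[OF entire_exp_has_field_derivative[OF assms]])

lemma higher_deriv_entire_exp:
  assumes "F \<in> airy_entire"
  shows "(deriv ^^ k) (entire_exp t s F) = entire_exp t s ((deriv ^^ k) F)"
  using assms by (induction k) (simp_all add: deriv_entire_exp airy_entire_higher_deriv)

lemma airy_entire_entire_exp:
  assumes F: "F \<in> airy_entire"
  shows "entire_exp t s F \<in> airy_entire"
proof -
  have "\<exists>C. \<forall>z. norm (entire_exp t s F z) \<le> C * exp (\<epsilon> * norm z powr (3/2))" if "\<epsilon> > 0" for \<epsilon>
  proof -
    obtain C where C: "C \<ge> 0"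
      "\<And>n z. norm ((entire_gen t s ^^ n) F z /\<^sub>R fact n) \<le> C * exp (\<epsilon> * norm z powr (3/2)) * (1/2) ^ n"
      using entire_exp_terms_bound[OF F \<open>\<epsilon> > 0\<close>, of t s] by auto
    \<comment> \<open>The factor 2 is the sum of the geometric series.\<close>
    have "norm (entire_exp t s F z) \<le> C * 2 * exp (\<epsilon> * norm z powr (3/2))" for z
    proof -
      let ?h = "\<lambda>n. C * exp (\<epsilon> * norm z powr (3/2)) * (1/2) ^ n"
      have h: "?h sums (C * exp (\<epsilon> * norm z powr (3/2)) * (1 / (1 - 1/2)))"
        by (intro sums_mult geometric_sums) auto
      have "norm (entire_exp t s F z) \<le> C * exp (\<epsilon> * norm z powr (3/2)) * (1 / (1 - 1/2))"
        by (rule norm_sums_le[OF entire_exp_sums[OF F] h C(2)])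
      then show ?thesis by (simp add: mult_ac)
    qed
    then show ?thesis by blast
  qed
  moreover have "entire_exp t s F holomorphic_on UNIV"
    using entire_exp_has_field_derivative[OF F] by (auto simp: holomorphic_on_open)
  ultimately show ?thesis by (auto simp: airy_entire_def)
qed

text \<open>The operator commutes with each A^n, and termwise differentiation carries this over to
  the sum.\<close>

lemma diff_poly_entire_exp:
  assumes F: "F \<in> airy_entire"
  shows "diff_poly a i b j (entire_exp t s F) = entire_exp t s (diff_poly a i b j F)"
proof
  fix z
  let ?A = "entire_gen t s"
  have hol: "F holomorphic_on UNIV" by (rule airy_entire_holomorphic[OF F])
  \<comment> \<open>Setting \<open>b = 0\<close> isolates a single power of D.\<close>
  have D: "(?A ^^ n) ((deriv ^^ k) F) = (deriv ^^ k) ((?A ^^ n) F)" for n k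
    using diff_poly_entire_gen_funpow[OF hol, where a = 1 and i = k and b = 0] by (simp add: diff_poly_def)
  have "(\<lambda>n. of_real a * ((?A ^^ n) ((deriv ^^ i) F) z /\<^sub>R fact n)
           + of_real b * ((?A ^^ n) ((deriv ^^ j) F) z /\<^sub>R fact n))
      sums (of_real a * entire_exp t s ((deriv ^^ i) F) z + of_real b * entire_exp t s ((deriv ^^ j) F) z)"
    by (intro sums_add sums_mult entire_exp_sums airy_entire_higher_deriv F)
  also have "of_real a * entire_exp t s ((deriv ^^ i) F) z + of_real b * entire_exp t s ((deriv ^^ j) F) z
      = diff_poly a i b j (entire_exp t s F) z"
    by (simp add: diff_poly_def higher_deriv_entire_exp[OF F])
  also have "(\<lambda>n. of_real a * ((?A ^^ n) ((deriv ^^ i) F) z /\<^sub>R fact n)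
           + of_real b * ((?A ^^ n) ((deriv ^^ j) F) z /\<^sub>R fact n))
      = (\<lambda>n. (?A ^^ n) (diff_poly a i b j F) z /\<^sub>R fact n)"
    unfolding diff_poly_entire_gen_funpow[OF hol, symmetric] D
    by (simp add: diff_poly_def scaleR_add_right)
  finally show "diff_poly a i b j (entire_exp t s F) z = entire_exp t s (diff_poly a i b j F) z"
    using entire_exp_sums[OF airy_entire_diff_poly[OF F]] sums_unique2 by blast
qed

lemma entire_gen_funpow_entire_exp:
  assumes "F \<in> airy_entire"
  shows "(entire_gen t' s' ^^ n) (entire_exp t s F) = entire_exp t s ((entire_gen t' s' ^^ n) F)"
proof (induction n)
  case (Suc n)
  then show ?case
    using diff_poly_entire_exp[OF airy_entire_entire_gen_funpow[OF assms]]
    by (simp add: entire_gen_def)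
qed auto

text \<open>The weight 1/n! turns n Q A^(n-1) into Q A^(n-1) / (n-1)!, so the extra terms form the
  shifted series of exp A applied to Q F, and Q then passes through exp A.\<close>

lemma entire_exp_mult_id:
  assumes F: "F \<in> airy_entire"
  shows "entire_exp t s (\<lambda>z. z * F z)
    = (\<lambda>z. z * entire_exp t s F z + gen_commutator t s (entire_exp t s F) z)"
proof
  fix z
  let ?A = "entire_gen t s" and ?Q = "gen_commutator t s"
  have Q: "?Q F \<in> airy_entire"
    unfolding gen_commutator_def by (rule airy_entire_diff_poly[OF F])
  let ?u = "\<lambda>n. of_nat n * (?A ^^ (n - 1)) (?Q F) z /\<^sub>R fact n"
  have "(\<lambda>n. ?u (Suc n)) = (\<lambda>n. (?A ^^ n) (?Q F) z /\<^sub>R fact n)"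
    by (rule ext) (simp add: scaleR_conv_of_real field_simps del: of_nat_Suc)
  then have "(\<lambda>n. ?u (Suc n)) sums entire_exp t s (?Q F) z"
    using entire_exp_sums[OF Q] by simp
  \<comment> \<open>The term \<open>?u 0\<close> is 0, so shifting the index leaves the sum
    unchanged.\<close>
  then have u: "?u sums entire_exp t s (?Q F) z"
    by (subst (asm) sums_Suc_iff) simp
  have "(\<lambda>n. z * ((?A ^^ n) F z /\<^sub>R fact n) + ?u n) sums (z * entire_exp t s F z + entire_exp t s (?Q F) z)"
    by (intro sums_add sums_mult entire_exp_sums F u)
  also have "(\<lambda>n. z * ((?A ^^ n) F z /\<^sub>R fact n) + ?u n)
      = (\<lambda>n. (?A ^^ n) (\<lambda>z. z * F z) z /\<^sub>R fact n)"
    unfolding entire_gen_funpow_mult_id[OF airy_entire_holomorphic[OF F]]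
    by (simp add: scaleR_add_right)
  also have "entire_exp t s (?Q F) = ?Q (entire_exp t s F)"
    unfolding gen_commutator_def by (rule diff_poly_entire_exp[OF F, symmetric])
  finally show "entire_exp t s (\<lambda>z. z * F z) z = z * entire_exp t s F z + ?Q (entire_exp t s F) z"
    using entire_exp_sums[OF airy_entire_mult_id[OF F]] sums_unique2 by blast
qed

subsection \<open>Inverting the exponential\<close>

text \<open>The binomial coefficient is at most 2^(m+n). In the double series below this leaves
  decay 2^-(m+n) out of 4^-(m+n).\<close>

lemma fact_add_le_power2: "fact (m + n) \<le> (2 ^ (m + n) * (fact m * fact n) :: real)"
proof -
  have "((m + n) choose m) \<le> 2 ^ (m + n)" by (rule binomial_le_pow2)
  then have "real ((m + n) choose m) \<le> 2 ^ (m + n)"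
    by (metis of_nat_le_iff of_nat_numeral of_nat_power)
  then have "fact (m + n) / (fact m * fact n) \<le> (2 ^ (m + n) :: real)"
    by (simp add: binomial_fact)
  then show ?thesis by (simp add: field_simps)
qed

text \<open>With c n = A^n F(z) the left side is the series of exp(-A) exp(A) F at z. Absolute
  summability allows summation along m + n = N, where the alternating binomial sum vanishes unless N
  = 0.\<close>

lemma alternating_double_exp_series:
  fixes c :: "nat \<Rightarrow> complex"
  assumes "\<And>n. norm (c n) \<le> C * (1/4) ^ n * fact n"
  shows "(\<lambda>m. (- 1) ^ m * (\<Sum>n. c (m + n) /\<^sub>R fact n) /\<^sub>R fact m) sums c 0"
proof -
  define h where "h = (\<lambda>(m, n). (- 1) ^ m * (c (m + n) /\<^sub>R fact n) /\<^sub>R fact m)"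
  have "C \<ge> 0" using assms[of 0] order_trans[OF norm_ge_zero[of "c 0"]] by simp
  have h_le: "norm (h (m, n)) \<le> C * (1/2) ^ m * (1/2) ^ n" for m n
  proof -
    have "norm (h (m, n)) = norm (c (m + n)) / (fact m * fact n)"
      by (simp add: h_def norm_mult norm_power field_simps)
    also have "\<dots> \<le> C * (1/4) ^ (m + n) * fact (m + n) / (fact m * fact n)"
      by (intro divide_right_mono assms) auto
    also have "\<dots> \<le> C * (1/4) ^ (m + n) * (2 ^ (m + n) * (fact m * fact n)) / (fact m * fact n)"
      using \<open>C \<ge> 0\<close> by (intro divide_right_mono mult_left_mono fact_add_le_power2) auto
    also have "\<dots> = C * (1/4 * 2) ^ (m + n)"
      by (simp only: power_mult_distrib) simp
    finally show ?thesis by (simp add: power_add)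
  qed
  have geo: "((\<lambda>n. a * (1/2) ^ n) has_sum (a * 2)) UNIV" if "a \<ge> 0" for a :: real
  proof (rule sums_nonneg_imp_has_sum)
    show "(\<lambda>n. a * (1/2) ^ n) sums (a * 2)"
      using sums_mult[OF geometric_sums[of "1/2 :: real"], of a] by simp
  qed (use that in auto)
  have "(\<lambda>p. C * (1/2) ^ fst p * (1/2) ^ snd p) summable_on (UNIV \<times> UNIV :: (nat \<times> nat) set)"
  proof (rule summable_on_SigmaI)
    fix m :: nat
    show "((\<lambda>n. C * (1/2) ^ fst (m, n) * (1/2) ^ snd (m, n)) has_sum (C * (1/2) ^ m * 2)) UNIV"
      using geo[of "C * (1/2) ^ m"] \<open>C \<ge> 0\<close> by simp
  next
    show "(\<lambda>m. C * (1/2) ^ m * 2) summable_on (UNIV :: nat set)"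
      using geo[of "C * 2"] \<open>C \<ge> 0\<close> by (auto simp: summable_on_def mult_ac)
  qed (use \<open>C \<ge> 0\<close> in auto)
  then have "(\<lambda>p. norm (h p)) summable_on (UNIV \<times> UNIV)"
    by (rule Infinite_Sum.abs_summable_on_comparison_test') (use h_le in auto)
  then have "h summable_on (UNIV \<times> UNIV)"
    by (rule Infinite_Sum.abs_summable_summable)
  then obtain S where S: "(h has_sum S) (UNIV \<times> UNIV)"
    by (auto simp: summable_on_def)
  \<comment> \<open>Summing over n first gives the inner exponential series; its convergence is
    recovered from that of the row by undoing the factor (-1)^m / m!.\<close>
  have rows: "((\<lambda>n. h (m, n)) has_sum ((- 1) ^ m * (\<Sum>n. c (m + n) /\<^sub>R fact n) /\<^sub>R fact m)) UNIV" for m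
  proof (rule norm_summable_imp_has_sum)
    show sh: "summable (\<lambda>n. norm (h (m, n)))"
      by (rule summable_comparison_test'[where g = "\<lambda>n. C * (1/2) ^ m * (1/2) ^ n"])
         (use h_le in \<open>auto intro!: summable_mult summable_geometric\<close>)
    have "summable (\<lambda>n. (- 1) ^ m * fact m * h (m, n))"
      by (intro summable_mult summable_norm_cancel[OF sh])
    also have "(\<lambda>n. (- 1) ^ m * fact m * h (m, n)) = (\<lambda>n. c (m + n) /\<^sub>R fact n)"
      by (rule ext) (cases "even m"; simp add: h_def scaleR_conv_of_real field_simps)
    finally have "(\<lambda>n. c (m + n) /\<^sub>R fact n) sums (\<Sum>n. c (m + n) /\<^sub>R fact n)"
      by (rule summable_sums)
    then show "(\<lambda>n. h (m, n)) sums ((- 1) ^ m * (\<Sum>n. c (m + n) /\<^sub>R fact n) /\<^sub>R fact m)"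
      unfolding h_def prod.case by (intro sums_scaleR_right sums_mult)
  qed
  have "((\<lambda>m. (- 1) ^ m * (\<Sum>n. c (m + n) /\<^sub>R fact n) /\<^sub>R fact m) has_sum S) UNIV"
    by (rule has_sum_SigmaD[OF S]) (use rows in auto)
  moreover have "S = c 0"
  proof -
    let ?k = "\<lambda>(N, m). h (m, N - m)"
    \<comment> \<open>Reindex by antidiagonals: (m, n) corresponds to (N, m) with N = m + n and m
      \<le> N.\<close>
    have "(?k has_sum S) (Sigma UNIV (\<lambda>N. {..N}))"
      by (subst has_sum_reindex_bij_witness[where i = "\<lambda>(m, n). (m + n, m)" and j = "\<lambda>(N, m). (m, N - m)"
            and T = "UNIV \<times> UNIV" and h = h and s' = S]) (use S in auto)
    then have "((\<lambda>N. \<Sum>m\<le>N. h (m, N - m)) has_sum S) UNIV"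
      by (rule has_sum_SigmaD) (auto intro!: has_sum_finite)
    also have "(\<lambda>N. \<Sum>m\<le>N. h (m, N - m)) = (\<lambda>N. if N = 0 then c 0 else 0)"
    proof
      fix N
      have "(\<Sum>m\<le>N. h (m, N - m)) = (\<Sum>m\<le>N. c N / fact N * (of_nat (N choose m) * (- 1) ^ m * 1 ^ (N - m)))"
        by (rule sum.cong) (auto simp: h_def scaleR_conv_of_real binomial_fact field_simps)
      \<comment> \<open>The binomial theorem; the power of 0 is 1 exactly at N = 0.\<close>
      also have "\<dots> = c N / fact N * (- 1 + 1) ^ N"
        by (simp only: sum_distrib_left binomial_ring)
      finally show "(\<Sum>m\<le>N. h (m, N - m)) = (if N = 0 then c 0 else 0)" by simp
    qed
    finally have "(\<lambda>N. if N = 0 then c 0 else 0) sums S"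
      by (rule has_sum_imp_sums)
    then show ?thesis
      by (rule sums_unique2[OF _ sums_single[where f = "\<lambda>_. c 0" and i = 0]])
  qed
  ultimately show ?thesis using has_sum_imp_sums by blast
qed

text \<open>-A is the generator with negated parameters. The results on entire functions carry no
  sign condition on \<open>t\<close> and \<open>s\<close>, so they apply to exp(-A) as well.\<close>

lemma entire_gen_funpow_uminus:
  assumes "F holomorphic_on UNIV"
  shows "(entire_gen (- t) (- s) ^^ n) F = (\<lambda>z. (- 1) ^ n * (entire_gen t s ^^ n) F z)"
proof (induction n)
  case (Suc n)
  have "entire_gen (- t) (- s) G = (\<lambda>z. - entire_gen t s G z)" for G
    by (simp add: entire_gen_def diff_poly_def fun_eq_iff)
  moreover have "entire_gen t s (\<lambda>z. (- 1) ^ n * (entire_gen t s ^^ n) F z)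
      = (\<lambda>z. (- 1) ^ n * (entire_gen t s ^^ Suc n) F z)"
    using diff_poly_lincomb[OF holomorphic_entire_gen_funpow[OF assms] holomorphic_entire_gen_funpow[OF assms],
        where d = 0 and c = "(- 1) ^ n"]
    by (simp add: entire_gen_def)
  ultimately show ?case unfolding funpow.simps comp_def Suc.IH by simp
qed auto

lemma entire_exp_uminus_entire_exp:
  assumes F: "F \<in> airy_entire"
  shows "entire_exp (- t) (- s) (entire_exp t s F) = F"
proof
  fix z
  let ?A = "entire_gen t s"
  \<comment> \<open>The rate 1/4 is the one that \<open>alternating_double_exp_series\<close> asks
    for.\<close>
  obtain C where C:
    "\<And>n z. norm ((?A ^^ n) F z) \<le> C * (1/4) ^ n * fact n * exp (1 * norm z powr (3/2))"
    by (rule entire_gen_funpow_growth[OF F _ zero_less_one, where q = "1/4" and t = t and s = s]) auto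
  let ?c = "\<lambda>n. (?A ^^ n) F z"
  have "(entire_gen (- t) (- s) ^^ m) (entire_exp t s F) z /\<^sub>R fact m
      = (- 1) ^ m * (\<Sum>n. ?c (m + n) /\<^sub>R fact n) /\<^sub>R fact m" for m
  proof -
    have "(?A ^^ m) (entire_exp t s F) z = (\<Sum>n. ?c (n + m) /\<^sub>R fact n)"
      unfolding entire_gen_funpow_entire_exp[OF F] by (simp add: entire_exp_def funpow_add)
    then show ?thesis
      using entire_gen_funpow_uminus[OF airy_entire_holomorphic[OF airy_entire_entire_exp[OF F]], where n = m]
      by (simp add: add.commute)
  qed
  moreover have "(\<lambda>m. (- 1) ^ m * (\<Sum>n. ?c (m + n) /\<^sub>R fact n) /\<^sub>R fact m) sums ?c 0"
    using C by (intro alternating_double_exp_series[where C = "C * exp (1 * norm z powr (3/2))"])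
      (simp add: mult_ac)
  ultimately have "(\<lambda>m. (entire_gen (- t) (- s) ^^ m) (entire_exp t s F) z /\<^sub>R fact m) sums F z"
    by simp
  then show "entire_exp (- t) (- s) (entire_exp t s F) z = F z"
    using sums_unique2[OF entire_exp_sums[OF airy_entire_entire_exp[OF F]]] by blast
qed

subsection \<open>Restriction to the real line\<close>

definition real_restrict :: "(complex \<Rightarrow> complex) \<Rightarrow> real \<Rightarrow> complex" where
  "real_restrict F = (\<lambda>x. F (of_real x))"

lemma heat_airy_domain_eq: "heat_airy_domain = real_restrict ` airy_entire"
  by (rule set_eqI)
     (simp add: heat_airy_domain_def airy_entire_def real_restrict_def image_iff Bex_def fun_eq_iff conj_assoc)

text \<open>The derivative of a holomorphic function along the real axis is its complex derivative,
  so identities for entire functions descend to their restrictions.\<close>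

lemma diff_op_real_restrict:
  assumes "F holomorphic_on UNIV"
  shows "diff_op (real_restrict F) = real_restrict (deriv F)"
  unfolding diff_op_def real_restrict_def
  using assms by (auto intro!: vector_derivative_of_real_right holomorphic_on_imp_differentiable_at[of _ UNIV])

lemma diff_op_funpow_real_restrict:
  assumes "F holomorphic_on UNIV"
  shows "(diff_op ^^ k) (real_restrict F) = real_restrict ((deriv ^^ k) F)"
proof (induction k)
  case (Suc k)
  have "(deriv ^^ k) F holomorphic_on UNIV"
    by (intro holomorphic_intros assms) auto
  then show ?case by (simp add: Suc.IH diff_op_real_restrict)
qed auto

lemma heat_airy_gen_real_restrict:
  assumes "F holomorphic_on UNIV"
  shows "heat_airy_gen t s (real_restrict F) = real_restrict (entire_gen t s F)"
  unfolding heat_airy_gen_def diff_op_funpow_real_restrict[OF assms]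
  by (simp add: real_restrict_def entire_gen_def diff_poly_def scaleR_conv_of_real)

lemma heat_airy_gen_funpow_real_restrict:
  assumes "F holomorphic_on UNIV"
  shows "(heat_airy_gen t s ^^ n) (real_restrict F) = real_restrict ((entire_gen t s ^^ n) F)"
  by (induction n) (simp_all add: heat_airy_gen_real_restrict holomorphic_entire_gen_funpow[OF assms])

lemma exp_converges_real_restrict:
  assumes "F \<in> airy_entire"
  shows "exp_converges (heat_airy_gen t s) (real_restrict F)"
  unfolding exp_converges_def heat_airy_gen_funpow_real_restrict[OF airy_entire_holomorphic[OF assms]]
  using summable_norm_entire_exp[OF assms] by (simp add: real_restrict_def)

lemma exp_op_real_restrict:
  assumes "F \<in> airy_entire"
  shows "exp_op (heat_airy_gen t s) (real_restrict F) = real_restrict (entire_exp t s F)"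
  unfolding exp_op_def heat_airy_gen_funpow_real_restrict[OF airy_entire_holomorphic[OF assms]]
  by (simp add: real_restrict_def entire_exp_def)

lemma neg_op_heat_airy_gen: "neg_op (heat_airy_gen t s) = heat_airy_gen (- t) (- s)"
  by (simp add: fun_eq_iff neg_op_def heat_airy_gen_def)

lemma position_op_real_restrict: "position_op (real_restrict F) = real_restrict (\<lambda>z. z * F z)"
  by (simp add: position_op_def real_restrict_def scaleR_conv_of_real)

text \<open>Invariance of the domain makes the composition meaningful, convergence makes the
  exponentials genuine sums, and bijectivity makes \<open>inv_into\<close> a true inverse, which is
  identified with exp(-A).\<close>

theorem proposition2p4:
  fixes t s :: real
  assumes "t \<ge> 0" and "s \<ge> 0"
  shows "diff_op ` heat_airy_domain \<subseteq> heat_airy_domain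
    \<and> position_op ` heat_airy_domain \<subseteq> heat_airy_domain
    \<and> (\<forall>f\<in>heat_airy_domain. exp_converges (heat_airy_gen t s) f
          \<and> exp_converges (neg_op (heat_airy_gen t s)) f)
    \<and> bij_betw (heat_airy t s) heat_airy_domain heat_airy_domain
    \<and> (\<forall>f\<in>heat_airy_domain.
          inv_into heat_airy_domain (heat_airy t s) f = exp_op (neg_op (heat_airy_gen t s)) f)
    \<and> (\<forall>f\<in>heat_airy_domain.
          heat_airy t s (position_op (inv_into heat_airy_domain (heat_airy t s) f))
            = (\<lambda>x. position_op f x + t *\<^sub>R diff_op f x - s *\<^sub>R (diff_op ^^ 2) f x))"
proof -
  let ?P = "heat_airy t s" and ?P' = "exp_op (neg_op (heat_airy_gen t s))"
  have P: "?P (real_restrict F) = real_restrict (entire_exp t s F)" if "F \<in> airy_entire" for F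
    unfolding heat_airy_def by (rule exp_op_real_restrict[OF that])
  have P': "?P' (real_restrict F) = real_restrict (entire_exp (- t) (- s) F)" if "F \<in> airy_entire" for F
    unfolding neg_op_heat_airy_gen by (rule exp_op_real_restrict[OF that])
  \<comment> \<open>Inversion at the negated parameters gives the composition in the opposite
    order.\<close>
  have PP': "?P (?P' f) = f" "?P' f \<in> heat_airy_domain" if "f \<in> heat_airy_domain" for f
    using that entire_exp_uminus_entire_exp[of _ "- t" "- s"]
    by (auto simp: heat_airy_domain_eq P P' airy_entire_entire_exp)
  have P'P: "?P' (?P f) = f" "?P f \<in> heat_airy_domain" if "f \<in> heat_airy_domain" for f
    using that entire_exp_uminus_entire_exp[of _ t s]
    by (auto simp: heat_airy_domain_eq P P' airy_entire_entire_exp)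
  have bij: "bij_betw ?P heat_airy_domain heat_airy_domain"
    by (rule bij_betw_byWitness[where f' = ?P']) (use PP' P'P in auto)
  have inv: "inv_into heat_airy_domain ?P f = ?P' f" if "f \<in> heat_airy_domain" for f
    using bij PP'[OF that] by (intro inv_into_f_eq) (auto simp: bij_betw_def)
  have conj: "?P (position_op (?P' f)) = (\<lambda>x. position_op f x + t *\<^sub>R diff_op f x - s *\<^sub>R (diff_op ^^ 2) f x)"
    if f: "f \<in> heat_airy_domain" for f
  proof -
    obtain F where F: "F \<in> airy_entire" and fF: "f = real_restrict F"
      using f by (auto simp: heat_airy_domain_eq)
    \<comment> \<open>With G = exp(-A) F one has exp(A) G = F, so moving exp(A) past z in z G
      produces (z + Q) F.\<close>
    define G where "G = entire_exp (- t) (- s) F"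
    have G: "G \<in> airy_entire" unfolding G_def by (rule airy_entire_entire_exp[OF F])
    have GF: "entire_exp t s G = F"
      using entire_exp_uminus_entire_exp[OF F, of "- t" "- s"] by (simp add: G_def)
    have "?P (position_op (?P' f)) = real_restrict (entire_exp t s (\<lambda>z. z * G z))"
      by (simp add: fF P' P F position_op_real_restrict airy_entire_mult_id G flip: G_def)
    also have "\<dots> = real_restrict (\<lambda>z. z * F z + gen_commutator t s F z)"
      by (simp add: entire_exp_mult_id[OF G] GF)
    also have "\<dots> = (\<lambda>x. position_op f x + t *\<^sub>R diff_op f x - s *\<^sub>R (diff_op ^^ 2) f x)"
      unfolding fF position_op_real_restrict
        diff_op_real_restrict[OF airy_entire_holomorphic[OF F]]
        diff_op_funpow_real_restrict[OF airy_entire_holomorphic[OF F]]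
      by (simp add: real_restrict_def gen_commutator_def diff_poly_def scaleR_conv_of_real add_diff_eq)
    finally show ?thesis .
  qed
  have "diff_op ` heat_airy_domain \<subseteq> heat_airy_domain"
    by (auto simp: heat_airy_domain_eq diff_op_real_restrict airy_entire_holomorphic airy_entire_deriv)
  moreover have "position_op ` heat_airy_domain \<subseteq> heat_airy_domain"
    by (auto simp: heat_airy_domain_eq position_op_real_restrict airy_entire_mult_id)
  moreover have "exp_converges (heat_airy_gen t s) f \<and> exp_converges (neg_op (heat_airy_gen t s)) f"
    if "f \<in> heat_airy_domain" for f
    using that by (auto simp: heat_airy_domain_eq neg_op_heat_airy_gen exp_converges_real_restrict)
  ultimately show ?thesis
    using bij inv conj by simp
qed

end
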